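(* Let $(G,\sigma,w)$ be a positive connected signed graph with consensus index $\epsilon_0$ and let $0<\epsilon<\epsilon_0$. Suppose the node $\epsilon$-repelling curvature $\tau_\epsilon$ has a positive lower bound $K_\epsilon$, i.e. $\tau_\epsilon(i)\ge K_\epsilon>0$ for all $i\in V$. Then the second smallest eigenvalue $\lambda_2^{(\epsilon)}$ of $L_+-\epsilon L_-$ satisfies $$\lambda_2^{(\epsilon)}\ge\frac{2K_\epsilon}{|V|}.$$
   Context: A signed graph $(G,\sigma,w)$ consists of a finite simple undirected connected graph $G=(V,E)$, a symmetric signature $\sigma:E\to\{+1,-1\}$ and a symmetric weight $w:E\to\mathbb{R}_{\ge 0}$. Put $E_+=\sigma^{-1}(+1)$, $E_-=\sigma^{-1}(-1)$. Let $w^{\pm}$ be the restriction of $w$ to $E_\pm$, extended by zero to all pairs of vertices. Put $d_i^{\pm}=\sum_{j:(i,j)\in E_\pm}w_{ij}$. The signed graph is positive connected if its positive subgraph $(V,E_+,w^+)$ is connected. The matrices $L_\pm\in\mathbb{R}^{V\times V}$ are the Laplacians of $(V,E_\pm,w^\pm)$: $L_\pm(i,i)=d_i^\pm$, $L_\pm(i,j)=-w_{ij}$ if $(i,j)\in E_\pm$, and $L_\pm(i,j)=0$ otherwise. Let $n=|V|\ge 2$. The consensus index is $$\epsilon_0:=\sup\{\epsilon>0 : L_+-\epsilon L_-\text{ is positive semidefinite of rank } n-1\}$$ (the value $+\infty$ is allowed). For $0<\epsilon<\epsilon_0$ the $\epsilon$-repelling matrix is $\Omega_\epsilon^\sigma\in\mathbb{R}^{V\times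 V}$, $$\Omega_\epsilon^\sigma(i,j):=(\vec e_i-\vec e_j)^T(L_+-\epsilon L_-)^{\dagger}(\vec e_i-\vec e_j),$$ where $\dagger$ is the Moore–Penrose pseudoinverse and $\vec e_i$ are the standard basis vectors. The matrix $\Omega_\epsilon^\sigma$ is invertible, and the node $\epsilon$-repelling curvature $\tau_\epsilon:V\to\mathbb{R}$ is the unique solution of $\Omega_\epsilon^\sigma\tau_\epsilon=n\vec 1$, with $\vec 1$ the all-ones vector. Eigenvalues are counted with multiplicity. *)

theory Defs
  imports "HOL-Analysis.Analysis" "HOL-Computational_Algebra.Polynomial"
begin

text \<open>
  The vertex set is the type \<open>'v\<close>. An undirected edge \<open>{i, j}\<close> is represented by
  the two ordered pairs \<open>(i, j)\<close> and \<open>(j, i)\<close>. The values of the signature and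
  the weight outside the edge set are irrelevant.
\<close>

locale signed_graph =
  fixes E :: "('v::finite) rel"
    and \<sigma> :: "'v \<Rightarrow> 'v \<Rightarrow> int"
    and w :: "'v \<Rightarrow> 'v \<Rightarrow> real"
  assumes sym_E: "sym E"
    and irrefl_E: "irrefl E"
    and connected_E: "E\<^sup>* = UNIV"
    and signature: "(i, j) \<in> E \<Longrightarrow> \<sigma> i j \<in> {1, -1}"
    and sym_signature: "(i, j) \<in> E \<Longrightarrow> \<sigma> i j = \<sigma> j i"
    and weight_nonneg: "(i, j) \<in> E \<Longrightarrow> w i j \<ge> 0"
    and sym_weight: "(i, j) \<in> E \<Longrightarrow> w i j = w j i"

definition pos_edges :: "'v rel \<Rightarrow> ('v \<Rightarrow> 'v \<Rightarrow> int) \<Rightarrow> 'v rel" where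
  "pos_edges E \<sigma> = {(i, j). (i, j) \<in> E \<and> \<sigma> i j = 1}"

definition neg_edges :: "'v rel \<Rightarrow> ('v \<Rightarrow> 'v \<Rightarrow> int) \<Rightarrow> 'v rel" where
  "neg_edges E \<sigma> = {(i, j). (i, j) \<in> E \<and> \<sigma> i j = -1}"

definition positive_connected :: "'v rel \<Rightarrow> ('v \<Rightarrow> 'v \<Rightarrow> int) \<Rightarrow> bool" where
  "positive_connected E \<sigma> \<longleftrightarrow> (pos_edges E \<sigma>)\<^sup>* = UNIV"

definition laplacian :: "('v::finite) rel \<Rightarrow> ('v \<Rightarrow> 'v \<Rightarrow> real) \<Rightarrow> real^'v^'v" where
  "laplacian F w = (\<chi> i j. if i = j then (\<Sum>k | (i, k) \<in> F. w i k)
                           else if (i, j) \<in> F then - w i j else 0)"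

definition repelling_laplacian ::
  "('v::finite) rel \<Rightarrow> ('v \<Rightarrow> 'v \<Rightarrow> int) \<Rightarrow> ('v \<Rightarrow> 'v \<Rightarrow> real) \<Rightarrow> real \<Rightarrow> real^'v^'v" where
  "repelling_laplacian E \<sigma> w \<epsilon> =
     laplacian (pos_edges E \<sigma>) w - \<epsilon> *\<^sub>R laplacian (neg_edges E \<sigma>) w"

definition positive_semidefinite :: "real^'n^'n \<Rightarrow> bool" where
  "positive_semidefinite A \<longleftrightarrow> transpose A = A \<and> (\<forall>x. 0 \<le> x \<bullet> (A *v x))"

text \<open>
  The supremum is taken in the extended reals, so it is \<open>\<infinity>\<close> for an unbounded set
  and \<open>-\<infinity>\<close> for the empty set. For a positive connected graph the latter happens only if
  some edge weights vanish; then no \<open>\<epsilon> > 0\<close> lies below the index.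
\<close>

definition consensus_index ::
  "('v::finite) rel \<Rightarrow> ('v \<Rightarrow> 'v \<Rightarrow> int) \<Rightarrow> ('v \<Rightarrow> 'v \<Rightarrow> real) \<Rightarrow> ereal" where
  "consensus_index E \<sigma> w =
     Sup (ereal ` {\<epsilon>. \<epsilon> > 0 \<and> positive_semidefinite (repelling_laplacian E \<sigma> w \<epsilon>)
                     \<and> rank (repelling_laplacian E \<sigma> w \<epsilon>) = CARD('v) - 1})"

text \<open>The four Penrose conditions, which determine the pseudoinverse uniquely.\<close>

definition is_pseudoinverse :: "real^'n^'m \<Rightarrow> real^'m^'n \<Rightarrow> bool" where
  "is_pseudoinverse A X \<longleftrightarrow>
     A ** X ** A = A \<and> X ** A ** X = X \<and>
     transpose (A ** X) = A ** X \<and> transpose (X ** A) = X ** A"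

definition pseudoinverse :: "real^'n^'m \<Rightarrow> real^'m^'n" where
  "pseudoinverse A = (THE X. is_pseudoinverse A X)"

definition repelling_matrix ::
  "('v::finite) rel \<Rightarrow> ('v \<Rightarrow> 'v \<Rightarrow> int) \<Rightarrow> ('v \<Rightarrow> 'v \<Rightarrow> real) \<Rightarrow> real \<Rightarrow> real^'v^'v" where
  "repelling_matrix E \<sigma> w \<epsilon> =
     (\<chi> i j. (axis i 1 - axis j 1) \<bullet>
             (pseudoinverse (repelling_laplacian E \<sigma> w \<epsilon>) *v (axis i 1 - axis j 1)))"

definition node_curvature ::
  "('v::finite) rel \<Rightarrow> ('v \<Rightarrow> 'v \<Rightarrow> int) \<Rightarrow> ('v \<Rightarrow> 'v \<Rightarrow> real) \<Rightarrow> real \<Rightarrow> real^'v" where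
  "node_curvature E \<sigma> w \<epsilon> =
     (THE \<tau>. repelling_matrix E \<sigma> w \<epsilon> *v \<tau> = real CARD('v) *\<^sub>R (\<chi> i. 1))"

definition charpoly :: "real^'n^'n \<Rightarrow> real poly" where
  "charpoly A = det (mat [:0, 1:] - (\<chi> i j. [:A $ i $ j:]))"

text \<open>
  The real eigenvalues in increasing order, repeated according to their algebraic
  multiplicity. For a symmetric matrix the list has length \<open>CARD('n)\<close>.
\<close>

definition eigenvalues :: "real^'n^'n \<Rightarrow> real list" where
  "eigenvalues A = sorted_list_of_multiset (proots (charpoly A))"

definition second_smallest_eigenvalue :: "real^'n^'n \<Rightarrow> real" where
  "second_smallest_eigenvalue A = eigenvalues A ! 1"

end

theory Submission
  imports Defs
begin

text \<open>
  Write L = L_+ - \<epsilon> L_-, let X be its pseudoinverse, d the diagonal of X, \<Omega> the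
  repelling matrix, n = |V| and 1 the all-ones vector. The proof plays two readings of the
  quadratic form of \<Omega> against each other.

  Since \<Omega> = d 1^T + 1 d^T - 2X, an eigenvector f of L for an eigenvalue
  \<lambda> \<noteq> 0, being orthogonal to 1 and satisfying X f = \<lambda>^{-1} f, gives
  f^T \<Omega> f = -(2/\<lambda>) |f|^2. On the other hand \<Omega> is symmetric with nonnegative
  entries and \<Omega> \<tau> = n 1. If \<tau> \<ge> K > 0 then \<tau> is a positive weight for a Schur
  test (lemma \<open>schur_test\<close>), because \<Omega> diag(\<tau>)/n is a stochastic matrix, and the
  test gives - f^T \<Omega> f \<le> (n/K) |f|^2. Hence 2/\<lambda> \<le> n/K: every nonzero
  eigenvalue of L is at least 2K/n (lemma \<open>nonzero_eigenvalue_ge\<close>).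

  Three supporting facts make this an estimate for the second smallest eigenvalue.
  The matrix L is positive semidefinite with kernel spanned by 1: for
  \<epsilon> < \<epsilon>', it is a convex combination of L_+ and L_+ - \<epsilon>' L_-,
  and some \<epsilon>' from the set defining the consensus index exceeds \<epsilon> (lemma
  \<open>connected_laplacian_repelling_laplacian\<close>). The matrix \<Omega> is injective, so the
  curvature really solves its defining equation (lemma \<open>R_injective\<close>). Finally, by the spectral
  theorem the characteristic polynomial splits over the reals with roots belonging to an
  orthonormal basis of eigenvectors, so two eigenvalues below 2K/n would both be 0 and would
  come with two orthogonal unit vectors in the line spanned by 1.
\<close>

section \<open>Symmetric real matrices\<close>

lemma symmetric_matrix_inner:
  fixes A :: "real^'n^'n"
  assumes "transpose A = A"
  shows "(A *v x) \<bullet> y = x \<bullet> (A *v y)"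
  by (metis assms dot_lmul_matrix transpose_matrix_vector)

lemma symmetric_matrix_component:
  assumes "transpose A = A"
  shows "A $ i $ j = A $ j $ i"
proof -
  have "A $ i $ j = transpose A $ j $ i" by (simp add: transpose_def)
  then show ?thesis by (simp only: assms)
qed

text \<open>
  A zero v of the form minimises it on S, so its derivative there vanishes in every direction of
  S. Invariance of S puts A v itself among these directions.
  Allowing a subspace lets the lemma yield eigenvectors inside an invariant subspace.
\<close>
lemma psd_form_zero_imp_kernel:
  fixes A :: "real^'n^'n"
  assumes sym: "transpose A = A"
    and S: "subspace S" "\<And>x. x \<in> S \<Longrightarrow> A *v x \<in> S"
    and nonneg: "\<And>x. x \<in> S \<Longrightarrow> 0 \<le> x \<bullet> (A *v x)"
    and v: "v \<in> S" "v \<bullet> (A *v v) = 0"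
  shows "A *v v = 0"
proof (rule ccontr)
  assume "A *v v \<noteq> 0"
  define u a b where "u = A *v v" and "a = u \<bullet> u" and "b = u \<bullet> (A *v u)"
  have a: "a > 0" using \<open>A *v v \<noteq> 0\<close> by (simp add: u_def a_def)
  have u: "u \<in> S" using S v by (simp add: u_def)
  have b: "b \<ge> 0" using nonneg[OF u] by (simp add: b_def)
  \<comment> \<open>The form at v + t u is 2ta + t^2 b. Its minimiser is t = -a/b; adding 1 to the
    denominator avoids the case b = 0 and still gives a negative value.\<close>
  define t where "t = - a / (b + 1)"
  have "v + t *\<^sub>R u \<in> S" using u v S by (simp add: subspace_add subspace_scale)
  then have "0 \<le> (v + t *\<^sub>R u) \<bullet> (A *v (v + t *\<^sub>R u))" by (rule nonneg)
  also have "\<dots> = 2 * t * a + t\<^sup>2 * b"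
    using symmetric_matrix_inner[OF sym, of v u] v
    by (simp add: matrix_vector_right_distrib matrix_vector_mult_scaleR inner_add_left
        inner_add_right u_def[symmetric] a_def[symmetric] b_def[symmetric] power2_eq_square
        distrib_left)
  also have "\<dots> = (a\<^sup>2 / (b + 1)) * (b / (b + 1) - 2)"
    by (simp add: t_def power2_eq_square algebra_simps)
  also have "\<dots> < 0"
  proof (rule mult_pos_neg)
    show "0 < a\<^sup>2 / (b + 1)" using a b by simp
    have "b / (b + 1) < 1" using b by simp
    then show "b / (b + 1) - 2 < 0" by linarith
  qed
  finally show False by simp
qed

text \<open>
  Rayleigh's principle: the form attains a maximum l on the compact unit sphere of S. The form of
  l I - A is then nonnegative on S and vanishes at the maximiser, which is therefore an eigenvector.
\<close>
lemma symmetric_matrix_eigenvector_in_subspace: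
  fixes A :: "real^'n^'n"
  assumes sym: "transpose A = A"
    and S: "subspace S" "\<And>x. x \<in> S \<Longrightarrow> A *v x \<in> S"
    and nonzero: "x \<in> S" "x \<noteq> 0"
  obtains v l where "v \<in> S" "norm v = 1" "A *v v = l *\<^sub>R v"
proof -
  let ?C = "S \<inter> sphere 0 1"
  have "compact ?C"
    using closed_subspace[OF S(1)] by (simp add: closed_Int_compact)
  moreover have "x /\<^sub>R norm x \<in> ?C"
    using nonzero S by (simp add: subspace_scale)
  moreover have "continuous_on ?C (\<lambda>x. x \<bullet> (A *v x))"
    by (intro continuous_intros matrix_vector_mult_linear_continuous_on)
  ultimately obtain v where v: "v \<in> ?C" and max: "\<And>y. y \<in> ?C \<Longrightarrow> y \<bullet> (A *v y) \<le> v \<bullet> (A *v v)"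
    using continuous_attains_sup[of ?C "\<lambda>x. x \<bullet> (A *v x)"] by blast
  define l where "l = v \<bullet> (A *v v)"
  define M where "M = l *\<^sub>R mat 1 - A"
  have M: "M *v y = l *\<^sub>R y - A *v y" for y
    by (simp add: M_def matrix_vector_mult_diff_rdistrib scaleR_matrix_vector_assoc[symmetric])
  have "M *v v = 0"
  proof (rule psd_form_zero_imp_kernel[of M S])
    have "A $ i $ j = A $ j $ i" for i j
      using sym by (rule symmetric_matrix_component)
    then show "transpose M = M"
      by (simp add: M_def transpose_def vec_eq_iff mat_def)
    show "subspace S" "\<And>y. y \<in> S \<Longrightarrow> M *v y \<in> S"
      using S by (simp_all add: M subspace_diff subspace_scale)
    show "v \<in> S" using v by simp
    show "v \<bullet> (M *v v) = 0"
      using v by (simp add: M inner_diff_right l_def norm_eq_1)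
    show "0 \<le> y \<bullet> (M *v y)" if "y \<in> S" for y
    proof (cases "y = 0")
      case False
      have "y /\<^sub>R norm y \<in> ?C" using that S False by (simp add: subspace_scale)
      from max[OF this] have "(y \<bullet> (A *v y)) / (norm y)\<^sup>2 \<le> l"
        by (simp add: l_def matrix_vector_mult_scaleR power2_eq_square field_simps)
      then show ?thesis
        using False by (simp add: M inner_diff_right field_simps power2_norm_eq_inner)
    qed simp
  qed
  then have "A *v v = l *\<^sub>R v" by (simp add: M)
  with v show ?thesis by (intro that) auto
qed

text \<open>
  The spectral theorem. An orthonormal set of eigenvectors of maximal size must be a basis:
  otherwise its orthogonal complement is a nonzero invariant subspace, which contains one more
  eigenvector.
\<close>
theorem symmetric_matrix_orthonormal_eigenbasis:
  fixes A :: "real^'n^'n"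
  assumes sym: "transpose A = A"
  shows "\<exists>(v :: 'n \<Rightarrow> real^'n) l.
    (\<forall>i j. v i \<bullet> v j = (if i = j then 1 else 0)) \<and> (\<forall>i. A *v v i = l i *\<^sub>R v i)"
proof -
  define Q where "Q B \<longleftrightarrow> pairwise orthogonal B \<and> (\<forall>b\<in>B. norm b = 1 \<and> (\<exists>l. A *v b = l *\<^sub>R b))" for B
  have indep: "independent B" if "Q B" for B
    using that by (intro pairwise_orthogonal_independent) (auto simp: Q_def)
  have card_le: "finite B \<and> card B \<le> CARD('n)" if "Q B" for B
    using independent_bound[OF indep[OF that]] by simp
  have "Q {}" by (simp add: Q_def)
  then obtain B where B: "Q B" and max: "\<And>C. Q C \<Longrightarrow> card C \<le> card B"
    using ex_has_greatest_nat[of Q "{}" card "Suc CARD('n)"] card_le by (auto simp: less_Suc_eq_le)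
  have "card B = CARD('n)"
  proof (rule ccontr)
    assume "card B \<noteq> CARD('n)"
    then have "dim B < DIM(real^'n)"
      using card_le[OF B] by (simp add: dim_eq_card_independent[OF indep[OF B]])
    then obtain x where x: "x \<noteq> 0" "\<And>y. y \<in> span B \<Longrightarrow> orthogonal x y"
      using orthogonal_to_subspace_exists[of B] by blast
    define S where "S = {y. \<forall>b\<in>B. orthogonal b y}"
    obtain v l where v: "v \<in> S" "norm v = 1" "A *v v = l *\<^sub>R v"
    proof (rule symmetric_matrix_eigenvector_in_subspace[OF sym, of S x])
      show "subspace S" unfolding S_def by (rule subspace_orthogonal_to_vectors)
      show "A *v y \<in> S" if "y \<in> S" for y
      proof -
        have "b \<bullet> (A *v y) = 0" if b: "b \<in> B" for b
        proof -
          obtain m where "A *v b = m *\<^sub>R b" using B b by (auto simp: Q_def)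
          moreover have "b \<bullet> y = 0" using \<open>y \<in> S\<close> b by (simp add: S_def orthogonal_def)
          ultimately show ?thesis by (simp flip: symmetric_matrix_inner[OF sym])
        qed
        then show ?thesis by (simp add: S_def orthogonal_def)
      qed
      show "x \<in> S" using x(2) by (auto simp: S_def orthogonal_commute span_base)
      show "x \<noteq> 0" by (rule x(1))
    qed
    have "v \<notin> B" using v by (auto simp: S_def orthogonal_def norm_eq_1)
    moreover have "Q (insert v B)"
      using B v by (auto simp: Q_def S_def pairwise_insert orthogonal_commute)
    ultimately show False using max[of "insert v B"] card_le[OF B] by simp
  qed
  then obtain v :: "'n \<Rightarrow> real^'n" where v: "bij_betw v UNIV B"
    using finite_same_card_bij[of "UNIV :: 'n set" B] card_le[OF B] by auto
  then have vB: "v i \<in> B" for i by (auto simp: bij_betw_def)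
  have "\<exists>l. A *v v i = l *\<^sub>R v i" for i using B vB by (auto simp: Q_def)
  then obtain l where "\<And>i. A *v v i = l i *\<^sub>R v i" by metis
  moreover have "v i \<bullet> v j = (if i = j then 1 else 0)" for i j
  proof (cases "i = j")
    case True
    then show ?thesis using B vB by (simp add: Q_def norm_eq_1)
  next
    case False
    then have "v i \<noteq> v j" using v by (auto simp: bij_betw_def inj_on_def)
    then show ?thesis using False B vB by (auto simp: Q_def pairwise_def orthogonal_def)
  qed
  ultimately show ?thesis by blast
qed

section \<open>Eigenvalues as roots of the characteristic polynomial\<close>

lemma constant_poly_sum: "[:\<Sum>i\<in>I. f i:] = (\<Sum>i\<in>I. [:f i:])"
  proof (induction I rule: infinite_finite_induct)
  case (insert i I)
  have "[:f i + sum f I:] = [:f i:] + [:sum f I:]" by simp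
  with insert show ?case by simp
qed simp_all

text \<open>
  With the eigenvectors as the columns of P and D the diagonal matrix of the eigenvalues,
  (x I - A) P = P (x I - D) holds over the polynomial ring. Taking determinants, the
  factor det P can be cancelled, since orthonormality makes it a unit.
\<close>
lemma charpoly_eq_prod_eigenvalues:
  fixes A :: "real^'n^'n" and v :: "'n \<Rightarrow> real^'n"
  assumes orthonormal: "\<And>i j. v i \<bullet> v j = (if i = j then 1 else 0)"
    and eigen: "\<And>i. A *v v i = l i *\<^sub>R v i"
  shows "charpoly A = (\<Prod>i\<in>UNIV. [:- l i, 1:])"
proof -
  define M where "M = mat [:0, 1:] - (\<chi> i j. [:A $ i $ j:])"
  define P where "P = (\<chi> i j. [:v j $ i:])"
  define Q where "Q = (\<chi> i j. [:v i $ j:])"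
  define D :: "real poly^'n^'n" where "D = (\<chi> i j. if i = j then [:- l i, 1:] else 0)"
  have "(\<Sum>k\<in>UNIV. A $ i $ k * v j $ k) = l j * v j $ i" for i j
    using eigen[of j] by (simp add: vec_eq_iff matrix_vector_mult_def)
  then have AP: "(\<Sum>k\<in>UNIV. [:A $ i $ k:] * [:v j $ k:]) = [:l j * v j $ i:]" for i j
    by (simp add: constant_poly_sum[symmetric] mult.commute)
  have delta: "(\<Sum>k\<in>UNIV. (if i = k then c else 0) * g k) = c * g i"
    for i and c :: "real poly" and g :: "'n \<Rightarrow> real poly"
  proof -
    have "(if i = k then c else 0) * g k = (if i = k then c * g k else 0)" for k by simp
    then show ?thesis by simp
  qed
  have delta': "(\<Sum>k\<in>UNIV. g k * (if k = j then h k else 0)) = g j * h j"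
    for j and g h :: "'n \<Rightarrow> real poly"
  proof -
    have "g k * (if k = j then h k else 0) = (if k = j then g k * h k else 0)" for k by simp
    then show ?thesis by simp
  qed
  have "M ** P = P ** D"
  proof -
    have "(M ** P) $ i $ j = (P ** D) $ i $ j" for i j
    proof -
      have "(M ** P) $ i $ j = (\<Sum>k\<in>UNIV. (if i = k then [:0, 1:] else 0) * [:v j $ k:])
          - (\<Sum>k\<in>UNIV. [:A $ i $ k:] * [:v j $ k:])"
        by (simp add: M_def P_def matrix_matrix_mult_def mat_def left_diff_distrib sum_subtractf
            del: mult_pCons_left mult_pCons_right)
      also have "(\<Sum>k\<in>UNIV. (if i = k then [:0, 1:] else 0) * [:v j $ k:]) = [:0, 1:] * [:v j $ i:]"
        by (rule delta)
      also have "\<dots> - (\<Sum>k\<in>UNIV. [:A $ i $ k:] * [:v j $ k:]) = [:v j $ i:] * [:- l j, 1:]"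
        unfolding AP by simp
      also have "\<dots> = (\<Sum>k\<in>UNIV. [:v k $ i:] * (if k = j then [:- l k, 1:] else 0))"
        by (simp only: delta')
      also have "\<dots> = (P ** D) $ i $ j"
        by (simp add: P_def D_def matrix_matrix_mult_def)
      finally show ?thesis .
    qed
    then show ?thesis by (simp add: vec_eq_iff)
  qed
  then have "det M * det P = det P * det D" by (metis det_mul)
  moreover have "det P \<noteq> 0"
  proof -
    have "Q ** P = mat 1"
      using orthonormal
      by (auto simp: vec_eq_iff Q_def P_def matrix_matrix_mult_def mat_def inner_vec_def
          constant_poly_sum[symmetric] one_pCons)
    then have "det Q * det P = 1" by (metis det_I det_mul)
    then show ?thesis by auto
  qed
  ultimately have "det M = det D" by simp
  also have "det D = (\<Prod>i\<in>UNIV. [:- l i, 1:])"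
    by (subst det_diagonal) (simp_all add: D_def)
  finally show ?thesis by (simp add: charpoly_def M_def)
qed

text \<open>
  If the second entry of the sorted list of eigenvalues is below c, so is the first, and two
  different members of an orthonormal eigenbasis belong to these entries, even if the
  eigenvalues coincide.
\<close>
lemma second_smallest_eigenvalue_ge:
  fixes A :: "real^'n^'n"
  assumes sym: "transpose A = A" and card: "CARD('n) \<ge> 2"
    and orthonormal_pair: "\<And>x y l m. \<lbrakk>A *v x = l *\<^sub>R x; A *v y = m *\<^sub>R y; norm x = 1; norm y = 1; x \<bullet> y = 0\<rbrakk>
                           \<Longrightarrow> c \<le> l \<or> c \<le> m"
  shows "c \<le> second_smallest_eigenvalue A"
proof (rule ccontr)
  assume less: "\<not> c \<le> second_smallest_eigenvalue A"
  obtain v :: "'n \<Rightarrow> real^'n" and l where v: "\<And>i j. v i \<bullet> v j = (if i = j then 1 else 0)"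
    and l: "\<And>i. A *v v i = l i *\<^sub>R v i"
    using symmetric_matrix_orthonormal_eigenbasis[OF sym] by metis
  have "(\<Sum>i\<in>I. {#l i#}) = image_mset l (mset_set I)" if "finite I" for I
    using that by induction simp_all
  then have mset_eq: "mset (eigenvalues A) = image_mset l (mset_set UNIV)"
    by (simp add: eigenvalues_def charpoly_eq_prod_eigenvalues[OF v l] proots_prod)
  then have "length (eigenvalues A) = CARD('n)"
    by (metis size_image_mset size_mset size_mset_set)
  then obtain a b xs where ab: "eigenvalues A = a # b # xs"
    using card by (cases "eigenvalues A" rule: remdups_adj.cases) auto
  have "sorted (eigenvalues A)" by (simp add: eigenvalues_def)
  then have "a < c" "b < c"
    using less by (auto simp: ab second_smallest_eigenvalue_def)
  then have "2 \<le> size (filter_mset (\<lambda>t. t < c) (mset (eigenvalues A)))" by (simp add: ab)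
  also have "\<dots> = card {i. l i < c}"
    by (simp add: mset_eq filter_mset_image_mset)
  finally have "2 \<le> card {i. l i < c}" .
  then have "\<not> card {i. l i < c} \<le> Suc 0" by simp
  then obtain i j where "l i < c" "l j < c" "i \<noteq> j"
    by (auto simp: card_le_Suc0_iff_eq)
  then show False
    using orthonormal_pair[OF l[of i] l[of j]] v by (auto simp: norm_eq_1)
qed

section \<open>The Moore--Penrose pseudoinverse\<close>

lemma pseudoinverse_unique:
  assumes X: "is_pseudoinverse A X" and Y: "is_pseudoinverse A Y"
  shows "X = Y"
proof -
  note AXA = X[unfolded is_pseudoinverse_def, THEN conjunct1]
  note AYA = Y[unfolded is_pseudoinverse_def, THEN conjunct1]
  have "A ** X = transpose (A ** X)" using X by (simp add: is_pseudoinverse_def)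
  also have "\<dots> = transpose ((A ** Y) ** (A ** X))" by (simp add: AYA matrix_mul_assoc)
  also have "\<dots> = (A ** X) ** (A ** Y)"
    using X Y by (simp only: is_pseudoinverse_def matrix_transpose_mul[of "A ** Y"])
  also have "\<dots> = A ** Y" by (simp add: AXA matrix_mul_assoc)
  finally have AX: "A ** X = A ** Y" .
  have "X ** A = transpose (X ** A)" using X by (simp add: is_pseudoinverse_def)
  also have "\<dots> = transpose ((X ** A) ** (Y ** A))"
  proof -
    have "(X ** A) ** (Y ** A) = X ** (A ** Y ** A)" by (simp only: matrix_mul_assoc)
    then show ?thesis by (simp only: AYA)
  qed
  also have "\<dots> = (Y ** A) ** (X ** A)"
    using X Y by (simp only: is_pseudoinverse_def matrix_transpose_mul[of "X ** A"])
  also have "\<dots> = Y ** (A ** X ** A)" by (simp only: matrix_mul_assoc)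
  also have "\<dots> = Y ** A" by (simp only: AXA)
  finally have XA: "X ** A = Y ** A" .
  have "X = X ** A ** X" using X by (simp add: is_pseudoinverse_def)
  also have "\<dots> = Y ** (A ** X)" by (simp only: XA matrix_mul_assoc)
  also have "\<dots> = Y ** A ** Y" by (simp only: AX matrix_mul_assoc)
  also have "\<dots> = Y" using Y by (simp add: is_pseudoinverse_def)
  finally show ?thesis .
qed

lemma pseudoinverse_eqI: "is_pseudoinverse A X \<Longrightarrow> pseudoinverse A = X"
  unfolding pseudoinverse_def using pseudoinverse_unique by blast

section \<open>Matrices with the spectral shape of a connected Laplacian\<close>

abbreviation ones :: "real^'n" where "ones \<equiv> (\<chi> i. 1)"

text \<open>The orthogonal projection onto the constant vectors.\<close>
definition averaging :: "real^'n^'n" where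
  "averaging = (\<chi> i j. 1 / real CARD('n))"

lemma averaging_mult_vec:
  fixes x :: "real^'n"
  shows "averaging *v x = ((ones \<bullet> x) / real CARD('n)) *\<^sub>R ones"
  by (simp add: averaging_def matrix_vector_mult_def vec_eq_iff inner_vec_def sum_divide_distrib)

lemma transpose_averaging: "transpose averaging = averaging"
  by (simp add: averaging_def transpose_def)

lemma ones_inner_ones: "ones \<bullet> (ones :: real^'n) = real CARD('n)"
  by (simp add: inner_vec_def)

lemma averaging_idem: "averaging ** averaging = averaging"
  by (simp add: averaging_def matrix_matrix_mult_def vec_eq_iff)

lemma matrix_diff_ldistrib: "A ** (B - C) = A ** B - A ** C"
  for A :: "real^'n^'m" and B C :: "real^'k^'n"
  by (simp add: matrix_eq matrix_vector_mult_diff_rdistrib matrix_vector_mult_diff_distrib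
      flip: matrix_vector_mul_assoc)

lemma matrix_diff_rdistrib: "(A - B) ** C = A ** C - B ** C"
  for A B :: "real^'n^'m" and C :: "real^'k^'n"
  by (simp add: matrix_eq matrix_vector_mult_diff_rdistrib flip: matrix_vector_mul_assoc)

lemma span_ones_cases:
  assumes "x \<in> span {ones}"
  obtains c where "x = c *\<^sub>R ones"
  using assms by (auto simp: span_singleton)

text \<open>
  The two properties of the repelling Laplacian that the argument depends on. The
  off-diagonal entries may have either sign, so that negative edges are covered.
\<close>
locale connected_laplacian =
  fixes L :: "real^'v^'v"
  assumes psd: "positive_semidefinite L"
    and kernel: "L *v x = 0 \<longleftrightarrow> x \<in> span {ones}"
begin

lemma symmetric: "transpose L = L"
  and form_nonneg: "0 \<le> x \<bullet> (L *v x)"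
  using psd by (simp_all add: positive_semidefinite_def)

lemma L_ones: "L *v ones = 0"
  by (simp add: kernel span_base)

lemma ones_inner_L: "ones \<bullet> (L *v x) = 0"
  using symmetric_matrix_inner[OF symmetric, of ones x] by (simp add: L_ones)

lemma form_zero_imp_constant: "x \<bullet> (L *v x) = 0 \<Longrightarrow> x \<in> span {ones}"
  using psd_form_zero_imp_kernel[OF symmetric subspace_UNIV] form_nonneg kernel by auto

lemma L_averaging: "L ** averaging = 0"
  by (simp add: matrix_eq averaging_mult_vec L_ones matrix_vector_mult_scaleR
      flip: matrix_vector_mul_assoc)

lemma averaging_L: "averaging ** L = 0"
  by (simp add: matrix_eq averaging_mult_vec ones_inner_L flip: matrix_vector_mul_assoc)

text \<open>
  Adding the projection onto the kernel makes L positive definite. The pseudoinverse is then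
  (L + P)^{-1} - P, which the next lemma verifies.
\<close>
lemma invertible_L_plus_averaging: "invertible (L + averaging)"
proof -
  have "x = 0" if "(L + averaging) *v x = 0" for x
  proof -
    have "0 = x \<bullet> ((L + averaging) *v x)" using that by simp
    also have "\<dots> = x \<bullet> (L *v x) + (ones \<bullet> x)\<^sup>2 / real CARD('v)"
      by (simp add: matrix_vector_mult_add_rdistrib inner_add_right averaging_mult_vec
          inner_commute power2_eq_square)
    finally have "x \<bullet> (L *v x) = 0 \<and> (ones \<bullet> x)\<^sup>2 / real CARD('v) = 0"
      using form_nonneg[of x] by (simp add: add_nonneg_eq_0_iff)
    then have "x \<in> span {ones}" "ones \<bullet> x = 0"
      by (auto intro: form_zero_imp_constant)
    then show ?thesis by (auto elim!: span_ones_cases simp: ones_inner_ones)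
  qed
  then show ?thesis
    by (simp add: invertible_left_inverse matrix_left_invertible_ker)
qed

abbreviation X :: "real^'v^'v" where "X \<equiv> pseudoinverse L"

lemma pseudoinverse_props:
  "transpose X = X" "L ** X = mat 1 - averaging" "X ** L = mat 1 - averaging"
  "X ** L ** X = X"
proof -
  let ?P = "averaging :: real^'v^'v" and ?B = "L + averaging"
  obtain C where C: "?B ** C = mat 1" "C ** ?B = mat 1"
    using invertible_L_plus_averaging by (auto simp: invertible_def)
  have BP: "?B ** ?P = ?P" "?P ** ?B = ?P"
    using averaging_idem averaging_L L_averaging
    by (simp_all add: matrix_eq matrix_vector_mult_add_rdistrib matrix_vector_right_distrib
        flip: matrix_vector_mul_assoc)
  have CP: "C ** ?P = ?P"
    by (metis BP(1) C(2) matrix_mul_assoc matrix_mul_lid)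
  have PC: "?P ** C = ?P"
    by (metis BP(2) C(1) matrix_mul_assoc matrix_mul_rid)
  define Y where "Y = C - ?P"
  have L: "L = ?B - ?P" by simp
  have LY: "L ** Y = mat 1 - ?P"
    by (subst L) (simp only: Y_def matrix_diff_ldistrib matrix_diff_rdistrib C BP PC averaging_idem, simp)
  have YL: "Y ** L = mat 1 - ?P"
    by (subst L) (simp only: Y_def matrix_diff_ldistrib matrix_diff_rdistrib C BP CP averaging_idem, simp)
  have tP: "transpose (mat 1 - ?P) = mat 1 - ?P"
    using transpose_averaging by (simp add: transpose_def vec_eq_iff mat_def averaging_def)
  have LYL: "L ** Y ** L = L"
    by (simp add: LY matrix_diff_rdistrib averaging_L)
  have "?P ** Y = 0" by (simp add: Y_def matrix_diff_ldistrib PC averaging_idem)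
  then have YLY: "Y ** L ** Y = Y"
    by (simp add: YL matrix_diff_rdistrib)
  have "is_pseudoinverse L Y"
    by (simp add: is_pseudoinverse_def LYL YLY) (simp add: LY YL tP)
  then have XY: "X = Y" by (rule pseudoinverse_eqI)
  have "transpose C ** ?B = mat 1"
  proof -
    have "transpose ?B = ?B"
      using symmetric transpose_averaging by (simp add: transpose_def vec_eq_iff)
    then show ?thesis by (metis C(1) matrix_transpose_mul transpose_mat)
  qed
  then have "transpose C = C"
    by (metis C(1) matrix_mul_assoc matrix_mul_lid matrix_mul_rid)
  then show "transpose X = X"
    unfolding XY using transpose_averaging by (simp add: Y_def transpose_def vec_eq_iff)
  show "L ** X = mat 1 - averaging" "X ** L = mat 1 - averaging" "X ** L ** X = X"
    unfolding XY by (fact LY, fact YL, fact YLY)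
qed

lemma L_X: "L *v (X *v y) = y - ((ones \<bullet> y) / real CARD('v)) *\<^sub>R ones"
  by (simp add: matrix_vector_mul_assoc pseudoinverse_props matrix_vector_mult_diff_rdistrib averaging_mult_vec)

lemma X_L: "X *v (L *v y) = y - ((ones \<bullet> y) / real CARD('v)) *\<^sub>R ones"
  by (simp add: matrix_vector_mul_assoc pseudoinverse_props matrix_vector_mult_diff_rdistrib averaging_mult_vec)

lemma X_ones: "X *v ones = 0"
proof -
  have "L *v (X *v ones) = 0" by (simp add: L_X ones_inner_ones)
  then have "(X ** L ** X) *v ones = 0" by (simp flip: matrix_vector_mul_assoc)
  then show ?thesis by (simp only: pseudoinverse_props(4))
qed

text \<open>This identity transfers definiteness modulo constants from L to its pseudoinverse.\<close>
lemma X_form_eq_L_form: "y \<bullet> (X *v y) = (X *v y) \<bullet> (L *v (X *v y))"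
proof -
  have "(X *v y) \<bullet> ones = 0"
    by (simp add: symmetric_matrix_inner pseudoinverse_props X_ones)
  then show ?thesis by (simp add: L_X inner_diff_right inner_commute)
qed

lemma X_form_nonneg: "0 \<le> y \<bullet> (X *v y)"
  by (simp add: X_form_eq_L_form form_nonneg)

lemma X_form_zero_imp_constant:
  assumes "y \<bullet> (X *v y) = 0"
  shows "y \<in> span {ones}"
proof -
  have "X *v y \<in> span {ones}"
    using assms by (intro form_zero_imp_constant) (simp flip: X_form_eq_L_form)
  then have "L *v (X *v y) = 0" by (simp add: kernel)
  then obtain c where "y = c *\<^sub>R ones" by (auto simp: L_X)
  then show ?thesis by (simp add: span_scale span_base)
qed

end

section \<open>Effective resistances\<close>

definition resistance_matrix :: "real^'v^'v \<Rightarrow> real^'v^'v" where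
  "resistance_matrix L =
     (\<chi> i j. (axis i 1 - axis j 1) \<bullet> (pseudoinverse L *v (axis i 1 - axis j 1)))"

lemma axis_inner_matrix_axis: "axis i 1 \<bullet> (A *v axis j 1) = A $ i $ j" for A :: "real^'n^'m"
  by (simp add: inner_axis' matrix_vector_mult_basis column_def)

context connected_laplacian
begin

abbreviation R :: "real^'v^'v" where "R \<equiv> resistance_matrix L"

abbreviation d :: "real^'v" where "d \<equiv> (\<chi> i. X $ i $ i)"

lemma X_swap: "X $ i $ j = X $ j $ i"
  using pseudoinverse_props(1) by (rule symmetric_matrix_component)

lemma R_component: "R $ i $ j = X $ i $ i + X $ j $ j - 2 * X $ i $ j"
  by (simp add: resistance_matrix_def matrix_vector_mult_diff_distrib inner_diff_left
      inner_diff_right axis_inner_matrix_axis X_swap[of j i])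

text \<open>
  The matrix identity \<Omega> = d 1^T + 1 d^T - 2X applied to a vector: on vectors orthogonal to the
  constants the form of \<Omega> is -2 times that of X.
\<close>
lemma R_mult_vec: "R *v t = (ones \<bullet> t) *\<^sub>R d + (d \<bullet> t) *\<^sub>R ones - 2 *\<^sub>R (X *v t)"
proof -
  have "(\<Sum>j\<in>UNIV. R $ i $ j * t $ j)
      = (\<Sum>j\<in>UNIV. t $ j) * X $ i $ i + (\<Sum>j\<in>UNIV. X $ j $ j * t $ j)
        - 2 * (\<Sum>j\<in>UNIV. X $ i $ j * t $ j)" for i
    by (simp add: R_component left_diff_distrib distrib_right sum.distrib sum_subtractf
        sum_distrib_left sum_distrib_right mult.assoc mult.commute[of "X $ i $ i"])
  then show ?thesis
    by (simp add: vec_eq_iff matrix_vector_mult_def inner_vec_def)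
qed

lemma R_nonneg: "0 \<le> R $ i $ j"
  by (simp add: resistance_matrix_def X_form_nonneg)

lemma R_symmetric: "transpose R = R"
  by (simp add: vec_eq_iff transpose_def R_component X_swap)

text \<open>
  A vanishing diagonal entry of X would make a standard basis vector constant, which is possible
  only in dimension one.
\<close>
lemma trace_X_pos:
  assumes "CARD('v) \<ge> 2"
  shows "0 < ones \<bullet> d"
proof -
  have "0 < X $ i $ i" for i
  proof -
    have "axis i 1 \<notin> span {ones :: real^'v}"
    proof
      assume "axis i 1 \<in> span {ones :: real^'v}"
      then obtain c where "axis i 1 = c *\<^sub>R (ones :: real^'v)" by (rule span_ones_cases)
      then have c: "(axis i 1 :: real^'v) $ j = c" for j by simp
      have "UNIV \<noteq> {i}" using assms by (metis One_nat_def card.empty card.insert empty_iff finite.emptyI le_refl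
            not_less_eq_eq numeral_2_eq_2)
      then obtain j where "j \<noteq> i" by auto
      then show False using c[of i] c[of j] by (simp add: axis_def)
    qed
    then show ?thesis
      using X_form_zero_imp_constant[of "axis i 1"] X_form_nonneg[of "axis i 1"]
      by (auto simp: axis_inner_matrix_axis less_le)
  qed
  then show ?thesis by (simp add: inner_vec_def sum_pos)
qed

text \<open>
  Let s = 1^T t and p = d^T t. Applying L to the equation \<Omega> t = 0 expresses t through
  s, and applying X to the result brings back X t; comparing both gives two formulas
  for p, which differ by a positive multiple of s because X has positive trace.
  So s = 0, and then t = 0.
\<close>
lemma R_injective:
  assumes card: "CARD('v) \<ge> 2" and Rt: "R *v t = 0"
  shows "t = 0"
proof -
  define n s p where "n = real CARD('v)" and "s = ones \<bullet> t" and "p = d \<bullet> t"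
  have n: "n > 0" by (simp add: n_def)
  have 1: "2 *\<^sub>R (X *v t) = s *\<^sub>R d + p *\<^sub>R ones"
    using Rt by (simp add: R_mult_vec s_def p_def)
  then have "L *v (2 *\<^sub>R (X *v t)) = L *v (s *\<^sub>R d + p *\<^sub>R ones)" by simp
  then have "2 *\<^sub>R (t - (s / n) *\<^sub>R ones) = s *\<^sub>R (L *v d)"
    by (simp add: matrix_vector_mult_scaleR L_X matrix_vector_right_distrib L_ones n_def s_def)
  then have 2: "2 *\<^sub>R t = s *\<^sub>R (L *v d) + (2 * s / n) *\<^sub>R ones"
    by (simp add: algebra_simps)
  then have "X *v (2 *\<^sub>R t) = X *v (s *\<^sub>R (L *v d) + (2 * s / n) *\<^sub>R ones)" by simp
  then have "2 *\<^sub>R (X *v t) = s *\<^sub>R (d - ((ones \<bullet> d) / n) *\<^sub>R ones)"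
    by (simp add: matrix_vector_mult_scaleR X_L matrix_vector_right_distrib X_ones n_def)
  with 1 have "s *\<^sub>R d + p *\<^sub>R ones = s *\<^sub>R (d - ((ones \<bullet> d) / n) *\<^sub>R ones)" by simp
  then have "s * X $ i $ i + p = s * (X $ i $ i - (ones \<bullet> d) / n)" for i
    by (simp add: vec_eq_iff)
  then have p: "p = - s * (ones \<bullet> d) / n" by (simp add: algebra_simps)
  have "2 * p = d \<bullet> (2 *\<^sub>R t)" by (simp add: p_def)
  also have "\<dots> = s * (d \<bullet> (L *v d)) + 2 * s / n * (ones \<bullet> d)"
    unfolding 2 by (simp add: inner_add_right inner_commute)
  finally have "s * (d \<bullet> (L *v d) + 4 * (ones \<bullet> d) / n) = 0"
    unfolding p by (simp add: algebra_simps)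
  moreover have "d \<bullet> (L *v d) + 4 * (ones \<bullet> d) / n > 0"
    using form_nonneg[of d] trace_X_pos[OF card] n by (simp add: add_nonneg_pos)
  ultimately have "s = 0" by simp
  then show ?thesis using 2 by simp
qed

lemma ex1_curvature:
  assumes "CARD('v) \<ge> 2"
  shows "\<exists>!t. R *v t = b"
proof -
  have "inj ((*v) R)"
    using R_injective[OF assms] by (simp add: linear_injective_0)
  moreover have "surj ((*v) R)"
    by (metis calculation full_rank_injective full_rank_surjective)
  ultimately show ?thesis by (metis injD surjD)
qed

end

section \<open>Curvature and the spectral gap\<close>

text \<open>
  Schur's test: bound each product -2 x_i x_j by x_i^2 t_j / t_i + x_j^2 t_i / t_j. By
  symmetry of A both halves of the sum agree, and A t = c 1 evaluates the row sums of
  A_{ij} t_j, leaving c \<Sum>_i x_i^2 / t_i.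
\<close>
lemma schur_test:
  fixes A :: "real^'n^'n"
  assumes sym: "transpose A = A" and nonneg: "\<And>i j. 0 \<le> A $ i $ j"
    and t: "\<And>i. K \<le> t $ i" "0 < K" and At: "A *v t = c *\<^sub>R ones"
  shows "- (x \<bullet> (A *v x)) \<le> c / K * (x \<bullet> x)"
proof -
  have swap: "A $ i $ j = A $ j $ i" for i j
    using sym by (rule symmetric_matrix_component)
  have pos: "0 < t $ i" for i using t by (meson less_le_trans)
  have row: "(\<Sum>j\<in>UNIV. A $ i $ j * t $ j) = c" for i
    using At by (simp add: vec_eq_iff matrix_vector_mult_def)
  have c: "0 \<le> c"
    unfolding row[of undefined, symmetric] using nonneg pos by (intro sum_nonneg) (simp add: less_imp_le)
  have amgm: "- (2 * (x $ i * x $ j)) \<le> (x $ i)\<^sup>2 / t $ i * t $ j + (x $ j)\<^sup>2 / t $ j * t $ i" for i j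
  proof -
    have "0 \<le> (x $ i * t $ j + x $ j * t $ i)\<^sup>2 / (t $ i * t $ j)"
      using pos[of i] pos[of j] by simp
    also have "\<dots> = (x $ i)\<^sup>2 / t $ i * t $ j + (x $ j)\<^sup>2 / t $ j * t $ i + 2 * (x $ i * x $ j)"
      using pos[of i] pos[of j] by (simp add: field_simps power2_eq_square)
    finally show ?thesis by simp
  qed
  define S where "S = (\<Sum>i\<in>UNIV. \<Sum>j\<in>UNIV. A $ i $ j * ((x $ i)\<^sup>2 / t $ i * t $ j))"
  have "2 * - (x \<bullet> (A *v x)) = (\<Sum>i\<in>UNIV. \<Sum>j\<in>UNIV. A $ i $ j * (- (2 * (x $ i * x $ j))))"
    by (simp add: inner_vec_def matrix_vector_mult_def sum_distrib_left sum_negf algebra_simps)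
  also have "\<dots> \<le> (\<Sum>i\<in>UNIV. \<Sum>j\<in>UNIV. A $ i $ j * ((x $ i)\<^sup>2 / t $ i * t $ j + (x $ j)\<^sup>2 / t $ j * t $ i))"
    by (intro sum_mono mult_left_mono amgm nonneg)
  also have "\<dots> = S + (\<Sum>i\<in>UNIV. \<Sum>j\<in>UNIV. A $ j $ i * ((x $ j)\<^sup>2 / t $ j * t $ i))"
    by (simp add: S_def distrib_left sum.distrib swap)
  also have "(\<Sum>i\<in>UNIV. \<Sum>j\<in>UNIV. A $ j $ i * ((x $ j)\<^sup>2 / t $ j * t $ i)) = S"
    unfolding S_def by (rule sum.swap)
  finally have "- (x \<bullet> (A *v x)) \<le> S" by simp
  also have "S = (\<Sum>i\<in>UNIV. (x $ i)\<^sup>2 / t $ i * (\<Sum>j\<in>UNIV. A $ i $ j * t $ j))"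
    by (simp add: S_def sum_distrib_left mult_ac)
  also have "\<dots> \<le> (\<Sum>i\<in>UNIV. (x $ i)\<^sup>2 / K * c)"
    unfolding row using t c by (intro sum_mono mult_right_mono divide_left_mono) (auto simp: pos)
  also have "\<dots> = c / K * (x \<bullet> x)"
    by (simp add: inner_vec_def sum_distrib_left power2_eq_square algebra_simps)
  finally show ?thesis .
qed

context connected_laplacian
begin

text \<open>
  The core of the argument: the form of the resistance matrix at the eigenvector is known
  exactly from the eigenvalue, and bounded by Schur's test with the curvature as weight.
\<close>
lemma nonzero_eigenvalue_ge:
  assumes f: "L *v f = l *\<^sub>R f" "f \<noteq> 0" and l: "l \<noteq> 0"
    and K: "\<And>i. K \<le> t $ i" "0 < K" and t: "R *v t = real CARD('v) *\<^sub>R ones"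
  shows "2 * K / real CARD('v) \<le> l"
proof -
  let ?n = "real CARD('v)"
  have ff: "0 < f \<bullet> f" using f by simp
  have "l * (ones \<bullet> f) = 0" using ones_inner_L[of f] by (simp add: f)
  then have orth: "ones \<bullet> f = 0" using l by simp
  have "0 \<le> l * (f \<bullet> f)" using form_nonneg[of f] by (simp add: f)
  then have l_pos: "0 < l" using l ff by (simp add: zero_le_mult_iff)
  have "l *\<^sub>R (X *v f) = f"
    using X_L[of f] by (simp add: f orth matrix_vector_mult_scaleR)
  then have Xf: "X *v f = (1 / l) *\<^sub>R f"
    using l by (metis (no_types) divide_inverse_commute mult.right_neutral scaleR_one scaleR_scaleR left_inverse)
  have "2 / l * (f \<bullet> f) = - (f \<bullet> (R *v f))"
    by (simp add: R_mult_vec orth Xf inner_diff_right inner_add_right inner_commute[of f ones])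
  also have "\<dots> \<le> ?n / K * (f \<bullet> f)"
    using R_symmetric R_nonneg K t by (rule schur_test)
  finally have "2 / l \<le> ?n / K" using ff by (rule mult_right_le_imp_le)
  then show ?thesis using l_pos K by (simp add: field_simps)
qed

text \<open>
  Eigenvalues below the bound vanish, and the kernel is too small for two orthonormal eigenvectors.
\<close>
theorem second_smallest_eigenvalue_ge_curvature:
  assumes card: "CARD('v) \<ge> 2"
    and K: "\<And>i. K \<le> t $ i" "0 < K" and t: "R *v t = real CARD('v) *\<^sub>R ones"
  shows "2 * K / real CARD('v) \<le> second_smallest_eigenvalue L"
proof (rule second_smallest_eigenvalue_ge[OF symmetric card], rule ccontr)
  fix x y l m
  assume x: "L *v x = l *\<^sub>R x" "norm x = 1" and y: "L *v y = m *\<^sub>R y" "norm y = 1"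
    and xy: "x \<bullet> y = 0" and "\<not> (2 * K / real CARD('v) \<le> l \<or> 2 * K / real CARD('v) \<le> m)"
  then have "l = 0" "m = 0"
    using nonzero_eigenvalue_ge[OF x(1) _ _ K t] nonzero_eigenvalue_ge[OF y(1) _ _ K t] by force+
  then have "x \<in> span {ones}" "y \<in> span {ones}"
    using x y by (simp_all flip: kernel)
  then obtain a b where "x = a *\<^sub>R ones" "y = b *\<^sub>R ones"
    by (metis span_ones_cases)
  then show False using x y xy by (auto simp: ones_inner_ones)
qed

end

section \<open>The repelling Laplacian below the consensus index\<close>

text \<open>
  The difference form of the Laplacian. A loop would enter the diagonal of the matrix without
  contributing to the differences, so irreflexivity is essential here.
\<close>
lemma laplacian_mult_vec:
  assumes "irrefl F"
  shows "(laplacian F w *v x) $ i = (\<Sum>j\<in>UNIV. (if (i, j) \<in> F then w i j else 0) * (x $ i - x $ j))"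
proof -
  have nl: "(k, k) \<notin> F" for k using assms by (simp add: irrefl_def)
  define deg where "deg = (\<Sum>k\<in>UNIV. if (i, k) \<in> F then w i k else 0)"
  have "laplacian F w $ i $ j * x $ j
      = (if i = j then deg * x $ i else 0) - (if (i, j) \<in> F then w i j else 0) * x $ j" for j
    using nl by (simp add: laplacian_def deg_def sum.If_cases Int_def)
  then have "(laplacian F w *v x) $ i
      = deg * x $ i - (\<Sum>j\<in>UNIV. (if (i, j) \<in> F then w i j else 0) * x $ j)"
    by (simp add: matrix_vector_mult_def sum_subtractf)
  then show ?thesis
    by (simp add: deg_def sum_distrib_right right_diff_distrib sum_subtractf)
qed

lemma laplacian_ones: "irrefl F \<Longrightarrow> laplacian F w *v ones = 0"
  by (simp add: vec_eq_iff laplacian_mult_vec)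

lemma transpose_laplacian:
  assumes "sym F" "\<And>i j. (i, j) \<in> F \<Longrightarrow> w i j = w j i"
  shows "transpose (laplacian F w) = laplacian F w"
  using assms by (auto simp: transpose_def laplacian_def vec_eq_iff sym_def)

lemma laplacian_form_nonneg:
  assumes "sym F" "irrefl F" and w: "\<And>i j. (i, j) \<in> F \<Longrightarrow> w i j = w j i" "\<And>i j. (i, j) \<in> F \<Longrightarrow> 0 \<le> w i j"
  shows "0 \<le> x \<bullet> (laplacian F w *v x)"
proof -
  define W where "W i j = (if (i, j) \<in> F then w i j else 0)" for i j
  have W: "W i j = W j i" "0 \<le> W i j" for i j
    using assms by (auto simp: W_def sym_def)
  define S where "S = (\<Sum>i\<in>UNIV. \<Sum>j\<in>UNIV. W i j * (x $ i * (x $ i - x $ j)))"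
  have S: "x \<bullet> (laplacian F w *v x) = S"
    by (simp add: S_def inner_vec_def laplacian_mult_vec[OF assms(2)] W_def sum_distrib_left mult_ac)
  have "S = (\<Sum>i\<in>UNIV. \<Sum>j\<in>UNIV. W i j * (x $ j * (x $ j - x $ i)))"
    unfolding S_def by (subst sum.swap) (simp add: W(1))
  then have "2 * S = S + (\<Sum>i\<in>UNIV. \<Sum>j\<in>UNIV. W i j * (x $ j * (x $ j - x $ i)))" by simp
  also have "\<dots> = (\<Sum>i\<in>UNIV. \<Sum>j\<in>UNIV. W i j * (x $ i - x $ j)\<^sup>2)"
    unfolding S_def sum.distrib[symmetric]
    by (intro sum.cong refl) (simp add: power2_eq_square algebra_simps)
  also have "\<dots> \<ge> 0" using W by (intro sum_nonneg) simp
  finally show ?thesis using S by simp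
qed

text \<open>
  The kernel of a symmetric matrix is the orthogonal complement of its range, so here it is a line.
\<close>
lemma kernel_eq_span_ones:
  fixes A :: "real^'n^'n"
  assumes sym: "transpose A = A" and rank: "rank A = CARD('n) - 1" and ones: "A *v ones = 0"
  shows "A *v x = 0 \<longleftrightarrow> x \<in> span {ones}"
proof -
  let ?N = "{x. A *v x = 0}" and ?I = "range ((*v) A)"
  have sub: "subspace ?N" "subspace ?I"
    by (simp_all add: subspace_def matrix_vector_right_distrib matrix_vector_mult_scaleR)
       (metis matrix_vector_right_distrib matrix_vector_mult_scaleR matrix_vector_mult_0_right rangeI)
  have "?N = {y \<in> UNIV. \<forall>z\<in>?I. orthogonal z y}"
    by (auto simp: orthogonal_def symmetric_matrix_inner[OF sym] intro: vector_eq_ldot[THEN iffD1])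
  then have "dim ?N + dim ?I = CARD('n)"
    using dim_subspace_orthogonal_to_vectors[of ?I UNIV] sub by simp
  then have "dim ?N = 1"
    using rank zero_less_card_finite[where 'a='n] unfolding rank_dim_range by linarith
  moreover have "(ones :: real^'n) \<noteq> 0" by (simp add: vec_eq_iff)
  then have "dim (span {ones :: real^'n}) = 1" by simp
  moreover have "span {ones} \<subseteq> ?N"
    using sub ones by (intro span_minimal) auto
  ultimately have "span {ones} = ?N"
    using sub subspace_dim_equal[of "span {ones}" ?N] by simp
  then show ?thesis by blast
qed

text \<open>
  Any \<epsilon> below the supremum lies below some e in the set, but need not be known to lie in
  the set. The form of L_+ - \<epsilon> L_- equals
  (1 - \<epsilon>/e) times the nonnegative form of L_+ plus \<epsilon>/e times that of
  L_+ - e L_-, so it dominates a positive multiple of the latter: it inherits both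
  semidefiniteness and the smallness of the kernel.
\<close>
lemma connected_laplacian_repelling_laplacian:
  fixes E :: "('v::finite) rel"
  assumes "signed_graph E \<sigma> w" and pos: "0 < \<epsilon>" and below: "ereal \<epsilon> < consensus_index E \<sigma> w"
  shows "connected_laplacian (repelling_laplacian E \<sigma> w \<epsilon>)"
proof -
  interpret signed_graph E \<sigma> w by fact
  let ?P = "laplacian (pos_edges E \<sigma>) w" and ?N = "laplacian (neg_edges E \<sigma>) w"
  let ?L = "repelling_laplacian E \<sigma> w"
  have edges: "sym (pos_edges E \<sigma>)" "sym (neg_edges E \<sigma>)" "irrefl (pos_edges E \<sigma>)" "irrefl (neg_edges E \<sigma>)"
    using sym_E irrefl_E sym_signature by (auto simp: pos_edges_def neg_edges_def sym_def irrefl_def)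
  have wP: "w i j = w j i" "0 \<le> w i j" if "(i, j) \<in> pos_edges E \<sigma>" for i j
    using that sym_weight weight_nonneg by (auto simp: pos_edges_def)
  have wN: "w i j = w j i" "0 \<le> w i j" if "(i, j) \<in> neg_edges E \<sigma>" for i j
    using that sym_weight weight_nonneg by (auto simp: neg_edges_def)
  have sym_L: "transpose (?L e) = ?L e" for e
    using transpose_laplacian[OF edges(1) wP(1)] transpose_laplacian[OF edges(2) wN(1)]
    by (simp add: repelling_laplacian_def transpose_def vec_eq_iff)
  have L_mult: "?L e *v x = ?P *v x - e *\<^sub>R (?N *v x)" for e x
    by (simp add: repelling_laplacian_def matrix_vector_mult_diff_rdistrib scaleR_matrix_vector_assoc)
  have L_ones: "?L e *v ones = 0" for e
    by (simp add: L_mult laplacian_ones edges)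
  obtain e where e: "\<epsilon> < e" "positive_semidefinite (?L e)" "rank (?L e) = CARD('v) - 1"
    using below by (auto simp: consensus_index_def less_Sup_iff)
  have ge: "\<epsilon> / e * (x \<bullet> (?L e *v x)) \<le> x \<bullet> (?L \<epsilon> *v x)" for x
  proof -
    have "x \<bullet> (?L \<epsilon> *v x) = (1 - \<epsilon> / e) * (x \<bullet> (?P *v x)) + \<epsilon> / e * (x \<bullet> (?L e *v x))"
      using pos e by (simp add: L_mult inner_diff_right field_simps)
    moreover have "0 \<le> (1 - \<epsilon> / e) * (x \<bullet> (?P *v x))"
      using pos e laplacian_form_nonneg[OF edges(1,3) wP] by simp
    ultimately show ?thesis by simp
  qed
  have e_nonneg: "0 \<le> x \<bullet> (?L e *v x)" for x
    using e by (simp add: positive_semidefinite_def)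
  have nonneg: "0 \<le> x \<bullet> (?L \<epsilon> *v x)" for x
    using ge[of x] e_nonneg[of x] pos e by (meson divide_nonneg_nonneg less_imp_le less_trans mult_nonneg_nonneg order_trans)
  show ?thesis
  proof
    show "positive_semidefinite (?L \<epsilon>)"
      using sym_L nonneg by (simp add: positive_semidefinite_def)
    fix x
    show "?L \<epsilon> *v x = 0 \<longleftrightarrow> x \<in> span {ones}"
    proof
      assume "?L \<epsilon> *v x = 0"
      then have "\<epsilon> / e * (x \<bullet> (?L e *v x)) \<le> 0" using ge[of x] by simp
      then have "x \<bullet> (?L e *v x) = 0"
        using e_nonneg[of x] pos e by (simp add: mult_le_0_iff divide_le_0_iff)
      then have "?L e *v x = 0"
        using psd_form_zero_imp_kernel[OF sym_L subspace_UNIV] e_nonneg by simp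
      then show "x \<in> span {ones}"
        using kernel_eq_span_ones[OF sym_L e(3) L_ones] by simp
    next
      assume "x \<in> span {ones}"
      then show "?L \<epsilon> *v x = 0"
        by (auto elim!: span_ones_cases simp: matrix_vector_mult_scaleR L_ones)
    qed
  qed
qed

theorem theorem1p4:
  fixes E :: "('v::finite) rel"
    and \<sigma> :: "'v \<Rightarrow> 'v \<Rightarrow> int"
    and w :: "'v \<Rightarrow> 'v \<Rightarrow> real"
    and \<epsilon> K :: real
  assumes "signed_graph E \<sigma> w"
    and "CARD('v) \<ge> 2"
    and "positive_connected E \<sigma>"
    and "0 < \<epsilon>"
    and "ereal \<epsilon> < consensus_index E \<sigma> w"
    and "K > 0"
    and "\<And>i. node_curvature E \<sigma> w \<epsilon> $ i \<ge> K"
  shows "second_smallest_eigenvalue (repelling_laplacian E \<sigma> w \<epsilon>) \<ge> 2 * K / real CARD('v)"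
proof -
  interpret connected_laplacian "repelling_laplacian E \<sigma> w \<epsilon>"
    using assms(1,4,5) by (rule connected_laplacian_repelling_laplacian)
  have "repelling_matrix E \<sigma> w \<epsilon> = R"
    by (simp add: repelling_matrix_def resistance_matrix_def)
  then have "R *v node_curvature E \<sigma> w \<epsilon> = real CARD('v) *\<^sub>R ones"
    unfolding node_curvature_def using theI'[OF ex1_curvature[OF assms(2)]] by simp
  then show ?thesis
    using assms(2,6,7) by (intro second_smallest_eigenvalue_ge_curvature)
qed

end
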